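(* Let $k$ be a natural number. Then: (1) If $x\in[2k+1]^+$, then $\operatorname{Col}(x)\in[6k+4]^+$. (2) If $x\in[2k]^+$, then $\operatorname{Col}(x)\in[k]^+\cup[k+5]^+$.
   Context: $\mathbb{N}$ denotes the set of positive integers. The Collatz function $\operatorname{Col}:\mathbb{N}\to\mathbb{N}$ is defined by $\operatorname{Col}(x)=x/2$ if $x$ is even and $\operatorname{Col}(x)=3x+1$ if $x$ is odd. For an integer $m$, $[m]$ denotes the residue class of $m$ modulo $10$, regarded as the set of all integers congruent to $m$ modulo $10$, and $[m]^+=[m]\cap\mathbb{N}$ is the set of positive integers congruent to $m$ modulo $10$ (so, e.g., $[0]^+=\{10,20,\ldots\}$ and $[1]^+=\{1,11,21,\ldots\}$). *)

theory Defs
  imports "HOL-Number_Theory.Cong"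
begin

text \<open>The Collatz function is a self-map of the positive integers; the value \<open>Col 0 = 0\<close> that
  totality forces on us lies outside its intended domain.\<close>

definition Col :: "nat \<Rightarrow> nat" where
  "Col x = (if even x then x div 2 else 3 * x + 1)"

definition res_class :: "int \<Rightarrow> int set" where
  "res_class m = {a. [a = m] (mod 10)}"

text \<open>The intersection of \<^term>\<open>res_class m\<close> with the positive integers, as a set of naturals so that
  \<^const>\<open>Col\<close> applies to its elements.\<close>

definition pos_res_class :: "int \<Rightarrow> nat set" where
  "pos_res_class m = {n. n > 0 \<and> int n \<in> res_class m}"

end

theory Submission
  imports Defs
begin

text \<open>Since 10 is even, a residue class mod 10 fixes parity and hence the branch of
  \<open>Col\<close>. On an odd class, tripling preserves congruence mod 10, so the image lies in
  one class. On an even class, halving \<open>2 * m + 10 * q\<close> leaves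
  \<open>m + 5 * q\<close>, which is known only mod 5; the classes of \<open>m\<close> and
  \<open>m + 5\<close> are its two lifts mod 10. \<open>Col_odd_class\<close> and
  \<open>Col_even_class\<close> carry this out for any integer \<open>m\<close>.\<close>

text \<open>The quotient \<open>q\<close> is an integer, possibly negative, because \<open>m\<close>
  may exceed \<open>n\<close>.\<close>

lemma mem_pos_res_class: "n \<in> pos_res_class m \<longleftrightarrow> n > 0 \<and> (\<exists>q. int n = m + 10 * q)"
  unfolding pos_res_class_def res_class_def
  by (auto simp: cong_sym_eq[of "int n" m] cong_iff_lin[of m])

lemma Col_odd_class:
  assumes "x \<in> pos_res_class (2 * m + 1)"
  shows "Col x \<in> pos_res_class (6 * m + 4)"
proof -
  obtain q where q: "int x = 2 * m + 1 + 10 * q"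
    using assms by (auto simp: mem_pos_res_class)
  then have "odd (int x)" by simp
  then have "odd x" by simp
  \<comment> \<open>Tripling the offset \<open>10 * q\<close> gives the new quotient
    \<open>3 * q\<close>.\<close>
  moreover have "int (3 * x + 1) = 6 * m + 4 + 10 * (3 * q)"
    using q by simp
  ultimately show ?thesis
    unfolding mem_pos_res_class Col_def by auto
qed

lemma Col_even_class:
  assumes "x \<in> pos_res_class (2 * m)"
  shows "Col x \<in> pos_res_class m \<union> pos_res_class (m + 5)"
proof -
  obtain q where pos: "x > 0" and q: "int x = 2 * m + 10 * q"
    using assms by (auto simp: mem_pos_res_class)
  then have "even (int x)" by simp
  then have "even x" by simp
  then obtain y where y: "x = 2 * y" by blast
  have Col: "Col x = y" and y_pos: "y > 0"
    using pos by (simp_all add: y Col_def)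
  have y_eq: "int y = m + 5 * q"
    using q by (simp add: y)
  show ?thesis
  \<comment> \<open>The parity of \<open>q\<close> selects the lift: \<open>5 * q\<close> is 0 mod
    10 for even \<open>q\<close> and 5 for odd \<open>q\<close>.\<close>
  proof (cases "even q")
    case True
    then obtain r where "q = 2 * r" by blast
    then have "int y = m + 10 * r" using y_eq by simp
    then show ?thesis using y_pos by (auto simp: Col mem_pos_res_class)
  next
    case False
    then obtain r where "q = 2 * r + 1" by (rule oddE)
    then have "int y = m + 5 + 10 * r" using y_eq by simp
    then show ?thesis using y_pos by (auto simp: Col mem_pos_res_class)
  qed
qed

theorem lemma3p1:
  fixes k :: nat
  assumes "k > 0"
  shows "(\<forall>x \<in> pos_res_class (2 * int k + 1). Col x \<in> pos_res_class (6 * int k + 4)) \<and>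
    (\<forall>x \<in> pos_res_class (2 * int k). Col x \<in> pos_res_class (int k) \<union> pos_res_class (int k + 5))"
  using Col_odd_class Col_even_class by blast

end
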